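(* Let $\Gamma$ be a contraction in a Hilbert space $\mathcal{H}_0$. On $\mathcal{H}_0\times\mathcal{H}_0$ consider the unitary operator $$U=\begin{pmatrix}\Gamma&(1-\Gamma\Gamma^* )^{1/2}\\(1-\Gamma^*\Gamma)^{1/2}&-\Gamma^*\end{pmatrix}$$ and the orthogonal projections $P_\Gamma=\begin{pmatrix}1&0\\0&0\end{pmatrix}$ and $Q_\Gamma=U^*P_\Gamma U$. Then $$\begin{pmatrix}\Gamma&0\\0&0\end{pmatrix}=UQ_\Gamma P_\Gamma,$$ i.e. $\Gamma$ is the $1,1$ entry of a unitary operator times a product of projections. Moreover, $\Gamma$ is S-decomposable in $\mathcal{H}_0$ if and only if $Q_\Gamma P_\Gamma$ is S-decomposable in $\mathcal{H}_0\times\mathcal{H}_0$.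
   Context: A contraction is a bounded operator of norm at most $1$. A bounded operator $T$ is called S-decomposable if it has a singular value (Schmidt) decomposition $T=\sum_n s_n\langle\,\cdot\,,\xi_n\rangle\psi_n$ (strong convergence), where $\{\xi_n\}$ and $\{\psi_n\}$ are orthonormal systems indexed by the same index set (possibly finite or empty; countable in the separable case) and $s_n>0$ for all $n$; equivalently, $T^*T$ is diagonalizable (has an orthonormal basis of eigenvectors). *)

theory Defs
  imports "HOL-Analysis.Analysis"
begin

text \<open>
  Complex inner product spaces, as an extension of \<^class>\<open>real_inner\<close>. The complex inner product
  is linear in the first argument and antilinear in the second. Its real part is
  \<^const>\<open>inner\<close>, so positive definiteness and the relation to the norm are inherited.
\<close>

class complex_inner = real_inner +
  fixes scaleC :: "complex \<Rightarrow> 'a \<Rightarrow> 'a"  (infixr \<open>*\<^sub>C\<close> 75)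
    and cinner :: "'a \<Rightarrow> 'a \<Rightarrow> complex"
  assumes scaleC_add_right: "a *\<^sub>C (x + y) = a *\<^sub>C x + a *\<^sub>C y"
    and scaleC_add_left: "(a + b) *\<^sub>C x = a *\<^sub>C x + b *\<^sub>C x"
    and scaleC_scaleC: "a *\<^sub>C (b *\<^sub>C x) = (a * b) *\<^sub>C x"
    and scaleR_scaleC: "r *\<^sub>R x = complex_of_real r *\<^sub>C x"
    and cinner_commute: "cinner x y = cnj (cinner y x)"
    and cinner_add_left: "cinner (x + y) z = cinner x z + cinner y z"
    and cinner_scaleC_left: "cinner (a *\<^sub>C x) y = a * cinner x y"
    and inner_eq_Re_cinner: "inner x y = Re (cinner x y)"

class chilbert_space = complex_inner + complete_space

instantiation prod :: (complex_inner, complex_inner) complex_inner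
begin

definition scaleC_prod :: "complex \<Rightarrow> 'a \<times> 'b \<Rightarrow> 'a \<times> 'b" where
  "scaleC_prod a p = (a *\<^sub>C fst p, a *\<^sub>C snd p)"

definition cinner_prod :: "'a \<times> 'b \<Rightarrow> 'a \<times> 'b \<Rightarrow> complex" where
  "cinner_prod p q = cinner (fst p) (fst q) + cinner (snd p) (snd q)"

instance
proof
  fix a b :: complex and r :: real and x y z :: "'a \<times> 'b"
  show "a *\<^sub>C (x + y) = a *\<^sub>C x + a *\<^sub>C y"
    by (simp add: scaleC_prod_def scaleC_add_right)
  show "(a + b) *\<^sub>C x = a *\<^sub>C x + b *\<^sub>C x"
    by (simp add: scaleC_prod_def scaleC_add_left)
  show "a *\<^sub>C (b *\<^sub>C x) = (a * b) *\<^sub>C x"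
    by (simp add: scaleC_prod_def scaleC_scaleC)
  show "r *\<^sub>R x = complex_of_real r *\<^sub>C x"
    by (simp add: scaleC_prod_def scaleR_prod_def scaleR_scaleC)
  show "cinner x y = cnj (cinner y x)"
    by (simp add: cinner_prod_def cinner_commute[symmetric])
  show "cinner (x + y) z = cinner x z + cinner y z"
    by (simp add: cinner_prod_def cinner_add_left)
  show "cinner (a *\<^sub>C x) y = a * cinner x y"
    by (simp add: cinner_prod_def scaleC_prod_def cinner_scaleC_left distrib_left)
  show "inner x y = Re (cinner x y)"
    by (simp add: cinner_prod_def inner_prod_def inner_eq_Re_cinner)
qed

end

instance prod :: (chilbert_space, chilbert_space) chilbert_space ..

definition bounded_clinear :: "('a::complex_inner \<Rightarrow> 'b::complex_inner) \<Rightarrow> bool" where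
  "bounded_clinear T \<longleftrightarrow> bounded_linear T \<and> (\<forall>a x. T (a *\<^sub>C x) = a *\<^sub>C T x)"

definition contraction_op :: "('a::complex_inner \<Rightarrow> 'b::complex_inner) \<Rightarrow> bool" where
  "contraction_op T \<longleftrightarrow> bounded_clinear T \<and> onorm T \<le> 1"

text \<open>
  The descriptions below are meaningful for bounded operators on a Hilbert space, respectively
  for positive operators on a Hilbert space.
\<close>

definition cadjoint :: "('a::chilbert_space \<Rightarrow> 'b::chilbert_space) \<Rightarrow> 'b \<Rightarrow> 'a" where
  "cadjoint T = (THE S. \<forall>x y. cinner (T x) y = cinner x (S y))"

definition positive_op :: "('a::chilbert_space \<Rightarrow> 'a) \<Rightarrow> bool" where
  "positive_op A \<longleftrightarrow> bounded_clinear A \<and> (\<forall>x. cinner (A x) x \<in> \<real>\<^sub>\<ge>\<^sub>0)"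

definition sqrt_op :: "('a::chilbert_space \<Rightarrow> 'a) \<Rightarrow> 'a \<Rightarrow> 'a" where
  "sqrt_op A = (THE S. positive_op S \<and> S \<circ> S = A)"

definition unitary_op :: "('a::chilbert_space \<Rightarrow> 'a) \<Rightarrow> bool" where
  "unitary_op U \<longleftrightarrow> bounded_clinear U \<and> cadjoint U \<circ> U = id \<and> U \<circ> cadjoint U = id"

definition orthogonal_projection :: "('a::chilbert_space \<Rightarrow> 'a) \<Rightarrow> bool" where
  "orthogonal_projection P \<longleftrightarrow> bounded_clinear P \<and> P \<circ> P = P \<and> cadjoint P = P"

definition orthonormal_system :: "'i set \<Rightarrow> ('i \<Rightarrow> 'a::complex_inner) \<Rightarrow> bool" where
  "orthonormal_system I e \<longleftrightarrow> (\<forall>i\<in>I. \<forall>j\<in>I. cinner (e i) (e j) = (if i = j then 1 else 0))"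

text \<open>
  Index sets are taken among the subsets of the space itself. This is no restriction: the map
  sending an index to the corresponding vector of an orthonormal system is injective, so
  every system can be reindexed by a set of vectors.
\<close>

definition S_decomposable :: "('a::chilbert_space \<Rightarrow> 'a) \<Rightarrow> bool" where
  "S_decomposable T \<longleftrightarrow> bounded_clinear T \<and>
    (\<exists>(I :: 'a set) (s :: 'a \<Rightarrow> real) (\<xi> :: 'a \<Rightarrow> 'a) (\<psi> :: 'a \<Rightarrow> 'a).
      orthonormal_system I \<xi> \<and> orthonormal_system I \<psi> \<and> (\<forall>n\<in>I. s n > 0) \<and>
      (\<forall>x. ((\<lambda>n. (complex_of_real (s n) * cinner x (\<xi> n)) *\<^sub>C \<psi> n) has_sum T x) I))"

definition block_op ::
  "('a::chilbert_space \<Rightarrow> 'a) \<Rightarrow> ('a \<Rightarrow> 'a) \<Rightarrow> ('a \<Rightarrow> 'a) \<Rightarrow> ('a \<Rightarrow> 'a) \<Rightarrow> 'a \<times> 'a \<Rightarrow> 'a \<times> 'a" where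
  "block_op A B C D = (\<lambda>(x, y). (A x + B y, C x + D y))"

definition U_op :: "('a::chilbert_space \<Rightarrow> 'a) \<Rightarrow> 'a \<times> 'a \<Rightarrow> 'a \<times> 'a" where
  "U_op \<Gamma> = block_op
     \<Gamma>                                       (sqrt_op (\<lambda>x. x - \<Gamma> (cadjoint \<Gamma> x)))
     (sqrt_op (\<lambda>x. x - cadjoint \<Gamma> (\<Gamma> x)))  (\<lambda>x. - cadjoint \<Gamma> x)"

definition P_op :: "'a::chilbert_space \<times> 'a \<Rightarrow> 'a \<times> 'a" where
  "P_op = block_op id (\<lambda>x. 0) (\<lambda>x. 0) (\<lambda>x. 0)"

definition Q_op :: "('a::chilbert_space \<Rightarrow> 'a) \<Rightarrow> 'a \<times> 'a \<Rightarrow> 'a \<times> 'a" where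
  "Q_op \<Gamma> = cadjoint (U_op \<Gamma>) \<circ> P_op \<circ> U_op \<Gamma>"

end

theory Submission
  imports Defs
begin

text \<open>
  The square roots \<open>D = (1 - \<Gamma>\<^sup>*\<Gamma>)\<^sup>1\<^sup>/\<^sup>2\<close> and \<open>D' = (1 - \<Gamma>\<Gamma>\<^sup>*)\<^sup>1\<^sup>/\<^sup>2\<close> are \<open>1 - lim Y\<^sub>n\<close> for the
  iteration \<open>Y\<^sub>n\<^sub>+\<^sub>1 = (B + Y\<^sub>n\<^sup>2) / 2\<close> with \<open>B = \<Gamma>\<^sup>*\<Gamma>\<close> and \<open>B = \<Gamma>\<Gamma>\<^sup>*\<close>. It converges in norm because its increments
  are dominated by those of the same iteration for the number \<open>1\<close>. Each \<open>Y\<^sub>n\<close> is a polynomial in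
  \<open>B\<close>, so \<open>\<Gamma>\<close> intertwines the two square roots, \<open>\<Gamma> D = D' \<Gamma>\<close>, and unitarity of \<open>U\<close> is a block
  computation. Multiplying by a unitary operator on the left carries one singular value
  decomposition into another, which reduces the last claim to comparing \<open>\<Gamma>\<close> with \<open>\<Gamma> \<oplus> 0\<close>. There
  the vectors of any singular value decomposition of \<open>\<Gamma> \<oplus> 0\<close> have second component zero.
\<close>

section \<open>Complex inner products\<close>

instance chilbert_space \<subseteq> banach ..

text \<open>Most estimates below run with the real \<open>inner\<close>; this rule moves complex
  scalars across it.\<close>

lemma inner_scaleC_right: "inner x (a *\<^sub>C y) = inner (cnj a *\<^sub>C x) (y::'a::complex_inner)"
proof -
  have "cinner x (a *\<^sub>C y) = cnj (a * cinner y x)"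
    by (metis cinner_commute cinner_scaleC_left)
  also have "\<dots> = cnj a * cinner x y"
    by (simp add: cinner_commute[symmetric])
  also have "\<dots> = cinner (cnj a *\<^sub>C x) y"
    by (simp add: cinner_scaleC_left)
  finally show ?thesis by (simp add: inner_eq_Re_cinner)
qed

text \<open>Antilinearity in the second argument makes the real part of
  \<open>cinner x (\<i> *\<^sub>C y)\<close> the imaginary part of \<open>cinner x y\<close>.
  Statements about \<open>cinner\<close> thus reduce to statements about
  \<open>inner\<close>.\<close>

lemma cinner_eq_Complex: "cinner x y = Complex (inner x y) (inner x (\<i> *\<^sub>C (y::'a::complex_inner)))"
  by (simp add: inner_scaleC_right) (simp add: inner_eq_Re_cinner cinner_scaleC_left complex_eq_iff)

lemma scaleC_one: "1 *\<^sub>C x = (x::'a::complex_inner)"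
  using scaleR_scaleC[of 1 x] by simp

lemma scaleC_zero_left: "0 *\<^sub>C x = (0::'a::complex_inner)"
  using scaleR_scaleC[of 0 x] by simp

lemma scaleC_minus_left: "(- a) *\<^sub>C x = - (a *\<^sub>C (x::'a::complex_inner))"
  using scaleC_add_left[of a "-a" x] by (simp add: scaleC_zero_left eq_neg_iff_add_eq_0 add.commute)

lemma norm_scaleC: "norm (a *\<^sub>C x) = cmod a * norm (x::'a::complex_inner)"
proof -
  have "(norm (a *\<^sub>C x))\<^sup>2 = inner (of_real ((cmod a)\<^sup>2) *\<^sub>C x) x"
    by (simp only: power2_norm_eq_inner[of "a *\<^sub>C x"] inner_scaleC_right scaleC_scaleC
        complex_norm_square mult.commute)
  also have "\<dots> = (cmod a * norm x)\<^sup>2"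
    by (simp only: scaleR_scaleC[symmetric] inner_scaleR_left power_mult_distrib power2_norm_eq_inner)
  finally show ?thesis by (simp add: power2_eq_iff_nonneg)
qed

lemma bounded_linear_scaleC: "bounded_linear (\<lambda>x::'a::complex_inner. a *\<^sub>C x)"
proof (rule bounded_linear_intro)
  show "a *\<^sub>C (r *\<^sub>R x) = r *\<^sub>R (a *\<^sub>C x)" for r and x :: 'a
    by (simp add: scaleR_scaleC scaleC_scaleC mult.commute)
  show "norm (a *\<^sub>C x) \<le> norm x * cmod a" for x :: 'a
    by (simp add: norm_scaleC mult.commute)
qed (simp add: scaleC_add_right)

lemma scaleC_zero_right: "a *\<^sub>C 0 = (0::'a::complex_inner)"
  by (rule linear_simps(3)[OF bounded_linear_scaleC])

lemma bounded_linear_cinner_left: "bounded_linear (\<lambda>x. cinner x (y::'a::complex_inner))"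
proof -
  have "bounded_linear (\<lambda>x. of_real (inner x y) + of_real (inner x (\<i> *\<^sub>C y)) * \<i> :: complex)"
    by (intro bounded_linear_add bounded_linear_compose[OF bounded_linear_of_real]
        bounded_linear_compose[OF bounded_linear_mult_left] bounded_linear_inner_left)
  then show ?thesis
    by (simp add: cinner_eq_Complex Complex_eq mult.commute)
qed

lemma cinner_zero_left: "cinner 0 (y::'a::complex_inner) = 0"
  by (simp add: cinner_eq_Complex Complex_eq)

lemma cinner_zero_right: "cinner x (0::'a::complex_inner) = 0"
  by (metis cinner_commute cinner_zero_left complex_cnj_zero)

lemma cinner_eqD:
  assumes "\<And>x. cinner x y = cinner x (z::'a::complex_inner)"
  shows "y = z"
  using assms by (metis inner_eq_Re_cinner vector_eq_ldot)

lemma bounded_clinear_linear: "bounded_clinear T \<Longrightarrow> bounded_linear T"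
  by (simp add: bounded_clinear_def)

lemma bounded_clinear_scaleC: "bounded_clinear T \<Longrightarrow> T (a *\<^sub>C x) = a *\<^sub>C T x"
  by (simp add: bounded_clinear_def)

lemma bounded_clinear_compose:
  "bounded_clinear S \<Longrightarrow> bounded_clinear T \<Longrightarrow> bounded_clinear (S \<circ> T)"
  unfolding bounded_clinear_def
  by (auto simp: o_def intro: bounded_linear_compose)

section \<open>The adjoint\<close>

text \<open>The representing vector minimises \<open>\<parallel>x\<parallel>\<^sup>2 - 2 f x\<close>; minimising sequences are Cauchy by the
  parallelogram law.\<close>

lemma riesz_representation:
  fixes f :: "'a::{real_inner,complete_space} \<Rightarrow> real"
  assumes f: "bounded_linear f"
  obtains z where "\<And>x. f x = inner x z"
proof -
  interpret f: bounded_linear f by fact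
  define g where "g x = (norm x)\<^sup>2 - 2 * f x" for x
  obtain K where K: "\<And>x. norm (f x) \<le> norm x * K" using f.bounded by blast
  \<comment> \<open>Completing the square in \<open>norm x\<close>, with \<open>K\<close> a bound
    for \<open>f\<close>.\<close>
  have low: "g x \<ge> - K\<^sup>2" for x
  proof -
    have "f x \<le> norm x * K" using K[of x] by simp
    then have "g x \<ge> (norm x - K)\<^sup>2 - K\<^sup>2"
      unfolding g_def by (simp add: power2_diff)
    moreover have "(norm x - K)\<^sup>2 \<ge> 0" by simp
    ultimately show ?thesis by linarith
  qed
  define m where "m = Inf (range g)"
  have bdd: "bdd_below (range g)" using low by (meson bdd_belowI2)
  have m_le: "m \<le> g x" for x
    unfolding m_def by (rule cInf_lower[OF _ bdd]) simp
  have "\<exists>x. g x < m + 1 / real (Suc n)" for n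
  proof -
    have "Inf (range g) < m + 1 / real (Suc n)" by (simp add: m_def)
    from cInf_lessD[OF _ this] show ?thesis by auto
  qed
  then obtain X where X: "\<And>n. g (X n) < m + 1 / real (Suc n)" by metis
  \<comment> \<open>Parallelogram law; the contributions of \<open>f\<close> cancel by linearity. As
    \<open>g\<close> is at least \<open>m\<close> at the midpoint, two near-minimisers are close to
    each other.\<close>
  have par: "(norm (x - y))\<^sup>2 = 2 * g x + 2 * g y - 4 * g ((1/2) *\<^sub>R (x + y))" for x y
    unfolding g_def by (simp add: f.scaleR f.add power2_norm_eq_inner algebra_simps inner_commute)
  have dist: "(norm (X k - X l))\<^sup>2 < 4 * (1 / real (Suc n))" if "k \<ge> n" "l \<ge> n" for k l n
  proof -
    have "1 / real (Suc k) \<le> 1 / real (Suc n)" "1 / real (Suc l) \<le> 1 / real (Suc n)"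
      using that by (simp_all add: frac_le)
    then show ?thesis
      using par[of "X k" "X l"] X[of k] X[of l] m_le[of "(1/2) *\<^sub>R (X k + X l)"] by linarith
  qed
  have "Cauchy X"
  proof (rule CauchyI)
    fix e :: real assume "e > 0"
    then obtain n where n: "4 / e\<^sup>2 < real n" using reals_Archimedean2 by blast
    then have "4 < real (Suc n) * e\<^sup>2" using \<open>e > 0\<close> by (simp add: field_simps pos_add_strict)
    then have "4 * (1 / real (Suc n)) < e\<^sup>2" by (simp add: divide_less_eq mult.commute)
    then have "norm (X k - X l) < e" if "k \<ge> n" "l \<ge> n" for k l
      using dist[OF that] \<open>e > 0\<close> by (meson less_trans power_less_imp_less_base less_imp_le)
    then show "\<exists>M. \<forall>k\<ge>M. \<forall>l\<ge>M. norm (X k - X l) < e" by blast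
  qed
  then obtain z where z: "X \<longlonglongrightarrow> z" using Cauchy_convergent convergentD by blast
  have "(\<lambda>n. g (X n)) \<longlonglongrightarrow> g z"
    unfolding g_def by (intro tendsto_intros z f.tendsto)
  moreover have "(\<lambda>n. m + 1 / real (Suc n)) \<longlonglongrightarrow> m + 0"
    using LIMSEQ_inverse_real_of_nat by (intro tendsto_intros) (simp add: inverse_eq_divide)
  ultimately have "g z \<le> m + 0"
    by (rule LIMSEQ_le) (use X less_imp_le in blast)
  then have min: "g z \<le> g x" for x using m_le[of x] by simp
  have "f h = inner h z" for h
  proof -
    define d where "d = inner h z - f h"
    \<comment> \<open>The summand 1 keeps \<open>q\<close> positive also for \<open>h = 0\<close>,
      so that \<open>t = - d / q\<close> is available; it turns the quadratic inequality at the
      minimum into \<open>- d\<^sup>2 / q \<ge> 0\<close>.\<close>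
    define q where "q = inner h h + 1"
    have q: "q > 0" unfolding q_def by (simp add: add_nonneg_pos)
    have ex: "g (z + t *\<^sub>R h) = g z + 2 * t * d + t\<^sup>2 * inner h h" for t
      unfolding g_def d_def power2_norm_eq_inner
      by (simp add: f.scaleR f.add algebra_simps inner_commute power2_eq_square)
    have ge: "2 * t * d + t\<^sup>2 * inner h h \<ge> 0" for t
      using ex[of t] min[of "z + t *\<^sub>R h"] by simp
    have "2 * t * d + t\<^sup>2 * q \<ge> 0" for t
      using ge[of t] unfolding q_def by (simp add: algebra_simps add_increasing2)
    from this[of "- d / q"] have "d\<^sup>2 / q \<le> 0"
      using q by (simp add: power2_eq_square field_simps)
    then have "d = 0" using q by (simp add: divide_le_0_iff)
    then show ?thesis by (simp add: d_def)
  qed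
  then show ?thesis using that by blast
qed

lemma cadjointI:
  assumes "\<And>x y. cinner (T x) y = cinner x (S y)"
  shows "cadjoint T = S"
  unfolding cadjoint_def
proof (rule the_equality)
  show "\<forall>x y. cinner (T x) y = cinner x (S y)" using assms by blast
  show "S' = S" if "\<forall>x y. cinner (T x) y = cinner x (S' y)" for S'
  proof
    show "S' y = S y" for y by (rule cinner_eqD) (metis that assms)
  qed
qed

text \<open>The imaginary part is the real identity at \<open>\<i> *\<^sub>C y\<close>, once
  \<open>S\<close> commutes with the scalar.\<close>

lemma cinner_adjointI:
  assumes "\<And>a x. S (a *\<^sub>C x) = a *\<^sub>C S x" "\<And>x y. inner (T x) y = inner x (S y)"
  shows "cinner (T x) y = cinner x (S y)"
  by (simp add: cinner_eq_Complex assms)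

text \<open>Riesz representation of the real functional \<open>inner (T x) y\<close> of
  \<open>x\<close> yields a candidate \<open>S y\<close> for each \<open>y\<close>. Uniqueness of
  representing vectors makes \<open>S\<close> complex linear, and testing at \<open>x = S y\<close>
  bounds it.\<close>

lemma
  fixes T :: "'a::chilbert_space \<Rightarrow> 'b::chilbert_space"
  assumes T: "bounded_clinear T"
  shows bounded_clinear_cadjoint: "bounded_clinear (cadjoint T)"
    and cadjoint: "cinner (T x) y = cinner x (cadjoint T y)"
proof -
  interpret T: bounded_linear T using T by (rule bounded_clinear_linear)
  have "\<exists>z. \<forall>x. inner (T x) y = inner x z" for y
  proof -
    have "bounded_linear (\<lambda>x. inner (T x) y)"
      by (intro bounded_linear_compose[OF bounded_linear_inner_left] T.bounded_linear)
    then show ?thesis by (rule riesz_representation) blast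
  qed
  then obtain S where S: "\<And>x y. inner (T x) y = inner x (S y)" by metis
  have eqI: "u = v" if "\<And>x. inner x u = inner x v" for u v :: 'a
    using that vector_eq_ldot[of u v] by simp
  have scal: "S (a *\<^sub>C y) = a *\<^sub>C S y" for a y
    by (rule eqI) (simp add: S[symmetric] inner_scaleC_right bounded_clinear_scaleC[OF T, symmetric])
  obtain K where K: "K \<ge> 0" "\<And>x. norm (T x) \<le> norm x * K" using T.nonneg_bounded by blast
  have bl: "bounded_linear S"
  proof (rule bounded_linear_intro)
    show "S (x + y) = S x + S y" for x y
      by (rule eqI) (simp add: S[symmetric] inner_add_right)
    show "S (r *\<^sub>R x) = r *\<^sub>R S x" for r x
      by (rule eqI) (simp add: S[symmetric])
    show "norm (S y) \<le> norm y * K" for y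
    proof (cases "S y = 0")
      case False
      have "norm (S y) * norm (S y) = inner (T (S y)) y"
        by (simp add: S power2_norm_eq_inner[symmetric] power2_eq_square[symmetric])
      also have "\<dots> \<le> norm (T (S y)) * norm y" by (rule norm_cauchy_schwarz)
      also have "\<dots> \<le> norm (S y) * K * norm y" by (intro mult_right_mono K) simp
      finally show ?thesis using False by (simp add: mult.commute mult.left_commute)
    qed (simp add: K)
  qed
  have ad: "cinner (T x) y = cinner x (S y)" for x y
    by (rule cinner_adjointI) (auto simp: scal S)
  then have "cadjoint T = S" by (rule cadjointI)
  then show "bounded_clinear (cadjoint T)" "cinner (T x) y = cinner x (cadjoint T y)"
    using bl scal ad by (auto simp: bounded_clinear_def)
qed

lemma inner_cadjoint: "bounded_clinear T \<Longrightarrow> inner (T x) y = inner x (cadjoint T y)"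
  by (simp add: inner_eq_Re_cinner cadjoint)

lemma inner_cadjoint': "bounded_clinear T \<Longrightarrow> inner (cadjoint T y) x = inner y (T x)"
  by (metis inner_cadjoint inner_commute)

lemma cinner_cadjoint': "bounded_clinear T \<Longrightarrow> cinner (cadjoint T y) x = cinner y (T x)"
  by (metis cadjoint cinner_commute)

section \<open>Square roots\<close>

text \<open>Polarisation over the complex numbers: \<open>cinner (A u) u\<close> is real for every
  \<open>u\<close>, and the cross terms at \<open>u = x + \<i> *\<^sub>C y\<close> give
  symmetry.\<close>

lemma positive_op_symmetric:
  assumes A: "positive_op A"
  shows "inner (A x) y = inner x (A y)"
proof -
  have bc: "bounded_clinear A" using A by (simp add: positive_op_def)
  interpret A: bounded_linear A using bc by (rule bounded_clinear_linear)
  have z: "inner (A u) (\<i> *\<^sub>C u) = 0" for u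
    using A by (auto simp: positive_op_def cinner_eq_Complex complex_nonneg_Reals_iff)
  have "inner (A x) (\<i> *\<^sub>C (\<i> *\<^sub>C y)) + inner (A (\<i> *\<^sub>C y)) (\<i> *\<^sub>C x) = 0"
    using z[of "x + \<i> *\<^sub>C y"] z[of x] z[of "\<i> *\<^sub>C y"]
    by (simp add: A.add scaleC_add_right inner_add_left inner_add_right)
  moreover have "\<i> *\<^sub>C (\<i> *\<^sub>C y) = - y"
    by (simp add: scaleC_scaleC scaleC_minus_left scaleC_one)
  moreover have "inner (A (\<i> *\<^sub>C y)) (\<i> *\<^sub>C x) = inner (A y) x"
    by (simp add: bounded_clinear_scaleC[OF bc] inner_scaleC_right scaleC_scaleC scaleC_one)
  ultimately show ?thesis by (simp add: inner_commute)
qed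

lemma positive_op_inner_nonneg: "positive_op A \<Longrightarrow> inner (A x) x \<ge> 0"
  by (auto simp: positive_op_def cinner_eq_Complex complex_nonneg_Reals_iff)

text \<open>Symmetry makes the imaginary part of \<open>cinner (A x) x\<close> equal to its own
  negative, so positivity can be tested on \<open>inner\<close>.\<close>

lemma positive_opI:
  assumes A: "bounded_clinear A" "\<And>x y. inner (A x) y = inner x (A y)" "\<And>x. inner (A x) x \<ge> 0"
  shows "positive_op A"
proof -
  have "inner (A x) (\<i> *\<^sub>C x) = 0" for x
  proof -
    have "inner (A x) (\<i> *\<^sub>C x) = inner x (\<i> *\<^sub>C A x)"
      by (simp add: A(2) bounded_clinear_scaleC[OF A(1)])
    also have "\<dots> = - inner (\<i> *\<^sub>C x) (A x)"
      by (simp add: inner_scaleC_right scaleC_minus_left)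
    also have "\<dots> = - inner (A x) (\<i> *\<^sub>C x)"
      by (simp add: inner_commute)
    finally show ?thesis by simp
  qed
  then show ?thesis
    using A by (simp add: positive_op_def cinner_eq_Complex complex_nonneg_Reals_iff)
qed

text \<open>The form of \<open>A\<close> at \<open>x + t *\<^sub>R A x\<close> is a nonnegative
  quadratic in \<open>t\<close> without constant term, so its linear coefficient, twice the squared
  norm of \<open>A x\<close>, vanishes.\<close>

lemma positive_op_kernel:
  assumes A: "positive_op A" and 0: "inner (A x) x = 0"
  shows "A x = 0"
proof -
  interpret A: bounded_linear A
    using A by (simp add: positive_op_def bounded_clinear_linear)
  define d where "d = inner (A x) (A x)"
  define q where "q = inner (A (A x)) (A x) + 1"
  have q: "q > 0" unfolding q_def using positive_op_inner_nonneg[OF A, of "A x"] by linarith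
  have ge: "2 * t * d + t\<^sup>2 * inner (A (A x)) (A x) \<ge> 0" for t
    using positive_op_inner_nonneg[OF A, of "x + t *\<^sub>R A x"] 0
    by (simp add: A.add A.scaleR inner_add_left inner_add_right d_def power2_eq_square
        positive_op_symmetric[OF A, of "A x" x] algebra_simps)
  have "2 * t * d + t\<^sup>2 * q \<ge> 0" for t
    using ge[of t] unfolding q_def by (simp add: algebra_simps add_increasing2)
  from this[of "- d / q"] have "d\<^sup>2 / q \<le> 0"
    using q by (simp add: power2_eq_square field_simps)
  then have "d = 0" using q by (simp add: divide_le_0_iff)
  then show ?thesis by (simp add: d_def)
qed

text \<open>For \<open>y = S x - T x\<close>, commutation and equal squares give
  \<open>S y + T y = 0\<close>. Both forms then vanish at \<open>y\<close>, so
  \<open>S y = T y = 0\<close>, and symmetry moves this back to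
  \<open>inner y y = 0\<close>.\<close>

lemma positive_sqrt_unique:
  assumes S: "positive_op S" and T: "positive_op T"
    and eq: "S \<circ> S = T \<circ> T" and comm: "S \<circ> T = T \<circ> S"
  shows "S = T"
proof
  fix x
  interpret S: bounded_linear S
    using S by (simp add: positive_op_def bounded_clinear_linear)
  interpret T: bounded_linear T
    using T by (simp add: positive_op_def bounded_clinear_linear)
  have eq': "S (S x) = T (T x)" and comm': "S (T x) = T (S x)" for x
    using eq comm by (metis comp_apply)+
  define y where "y = S x - T x"
  have "S y + T y = 0"
    by (simp add: y_def S.diff T.diff eq' comm')
  then have "inner (S y) y + inner (T y) y = 0"
    by (metis inner_add_left inner_zero_left)
  then have "inner (S y) y = 0" "inner (T y) y = 0"
    using positive_op_inner_nonneg[OF S, of y] positive_op_inner_nonneg[OF T, of y] by linarith+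
  then have "S y = 0" "T y = 0" using positive_op_kernel S T by blast+
  moreover have "inner y y = inner x (S y - T y)"
    by (metis (no_types, lifting) positive_op_symmetric[OF S] positive_op_symmetric[OF T]
        inner_diff_left inner_diff_right y_def)
  ultimately show "S x = T x" by (simp add: y_def)
qed

section \<open>The square root iteration\<close>

fun sqrt_iter :: "('a::real_normed_vector \<Rightarrow>\<^sub>L 'a) \<Rightarrow> nat \<Rightarrow> 'a \<Rightarrow>\<^sub>L 'a" where
  "sqrt_iter B 0 = 0"
| "sqrt_iter B (Suc n) = (1/2) *\<^sub>R (B + (sqrt_iter B n o\<^sub>L sqrt_iter B n))"

text \<open>The iteration \<open>sqrt_iter\<close> for the number 1, a majorant for norms and
  increments.\<close>

fun sqrt_iter_bound :: "nat \<Rightarrow> real" where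
  "sqrt_iter_bound 0 = 0"
| "sqrt_iter_bound (Suc n) = (1 + (sqrt_iter_bound n)\<^sup>2) / 2"

lemma sqrt_iter_bound_range: "0 \<le> sqrt_iter_bound n \<and> sqrt_iter_bound n \<le> 1"
  by (induction n) (auto simp: power_le_one)

lemma sqrt_iter_intertwine:
  assumes "C o\<^sub>L B = B' o\<^sub>L C"
  shows "C o\<^sub>L sqrt_iter B n = sqrt_iter B' n o\<^sub>L C"
proof -
  have pt: "C (B x) = B' (C x)" for x
    using assms by (metis blinfun_apply_blinfun_compose)
  have "C (sqrt_iter B n x) = sqrt_iter B' n (C x)" for x
    by (induction n arbitrary: x)
      (simp_all add: blinfun.add_left blinfun.add_right blinfun.scaleR_left blinfun.scaleR_right pt)
  then show ?thesis by (intro blinfun_eqI) simp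
qed

text \<open>Intertwining applied twice: \<open>B\<close> commutes with itself, hence with each
  iterate, hence iterates commute with each other.\<close>

lemma sqrt_iter_commute: "sqrt_iter B m o\<^sub>L sqrt_iter B n = sqrt_iter B n o\<^sub>L sqrt_iter B m"
  by (intro sqrt_iter_intertwine sqrt_iter_intertwine[symmetric] refl)

lemma norm_sqrt_iter:
  assumes "norm B \<le> 1"
  shows "norm (sqrt_iter B n) \<le> sqrt_iter_bound n"
proof (induction n)
  case (Suc n)
  have "norm (sqrt_iter B n o\<^sub>L sqrt_iter B n) \<le> (sqrt_iter_bound n)\<^sup>2"
    using norm_blinfun_compose[of "sqrt_iter B n" "sqrt_iter B n"] mult_mono[OF Suc Suc]
      sqrt_iter_bound_range[of n] by (simp add: power2_eq_square)
  then have "norm (B + (sqrt_iter B n o\<^sub>L sqrt_iter B n)) \<le> 1 + (sqrt_iter_bound n)\<^sup>2"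
    using assms by (metis norm_triangle_mono)
  then show ?case by simp
qed simp

text \<open>Since iterates commute, a difference of squares factors as
  \<open>(Y - Z) (Y + Z)\<close>, and the scalar majorant factors in the same way.\<close>

lemma norm_sqrt_iter_diff:
  assumes B: "norm B \<le> 1"
  shows "norm (sqrt_iter B (Suc n) - sqrt_iter B n) \<le> sqrt_iter_bound (Suc n) - sqrt_iter_bound n"
proof (induction n)
  case 0
  then show ?case using B by simp
next
  case (Suc n)
  let ?Y = "sqrt_iter B (Suc n)" and ?Z = "sqrt_iter B n"
  let ?y = "sqrt_iter_bound (Suc n)" and ?z = "sqrt_iter_bound n"
  have "sqrt_iter B (Suc (Suc n)) - ?Y = (1/2) *\<^sub>R ((?Y o\<^sub>L ?Y) - (?Z o\<^sub>L ?Z))"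
    by (simp only: sqrt_iter.simps(2) scaleR_diff_right[symmetric] add_diff_cancel_left)
  also have "(?Y o\<^sub>L ?Y) - (?Z o\<^sub>L ?Z) = (?Y - ?Z) o\<^sub>L (?Y + ?Z)"
    using sqrt_iter_commute[of B "Suc n" n]
    by (simp only: bounded_bilinear.diff_left[OF bounded_bilinear_blinfun_compose]
        bounded_bilinear.add_right[OF bounded_bilinear_blinfun_compose]) simp
  finally have "norm (sqrt_iter B (Suc (Suc n)) - ?Y) = (1/2) * norm ((?Y - ?Z) o\<^sub>L (?Y + ?Z))"
    by simp
  also have "norm ((?Y - ?Z) o\<^sub>L (?Y + ?Z)) \<le> norm (?Y - ?Z) * norm (?Y + ?Z)"
    by (rule norm_blinfun_compose)
  also have "\<dots> \<le> (?y - ?z) * (?y + ?z)"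
  proof (intro mult_mono Suc)
    show "norm (?Y + ?Z) \<le> ?y + ?z" by (intro norm_triangle_mono norm_sqrt_iter B)
    show "0 \<le> ?y - ?z" using Suc norm_ge_zero order_trans by blast
  qed simp
  also have "(1/2) * ((?y - ?z) * (?y + ?z)) = sqrt_iter_bound (Suc (Suc n)) - ?y"
    by (simp add: power2_eq_square algebra_simps)
  finally show ?case by simp
qed

text \<open>The scalar sequence is increasing and bounded, so its increments are summable;
  comparison makes the operator increments summable, and their partial sums telescope to the
  iterates.\<close>

lemma convergent_sqrt_iter:
  fixes B :: "'a::banach \<Rightarrow>\<^sub>L 'a"
  assumes B: "norm B \<le> 1"
  shows "convergent (sqrt_iter B)"
proof -
  let ?d = "\<lambda>n. sqrt_iter B (Suc n) - sqrt_iter B n"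
  let ?e = "\<lambda>n. sqrt_iter_bound (Suc n) - sqrt_iter_bound n"
  \<comment> \<open>Monotonicity comes for free: each scalar increment dominates a norm.\<close>
  have "0 \<le> ?e n" for n using norm_sqrt_iter_diff[OF B, of n] norm_ge_zero order_trans by blast
  then have "incseq sqrt_iter_bound" by (intro incseq_SucI) (simp add: algebra_simps)
  then obtain l where "sqrt_iter_bound \<longlonglongrightarrow> l"
    using incseq_convergent sqrt_iter_bound_range by blast
  then have "summable ?e" by (intro sums_summable[OF telescope_sums])
  then have "summable ?d"
    by (rule summable_comparison_test[rotated]) (use norm_sqrt_iter_diff[OF B] in blast)
  then have "convergent (\<lambda>n. \<Sum>i<n. ?d i)" by (simp add: summable_iff_convergent)
  moreover have "(\<Sum>i<n. ?d i) = sqrt_iter B n" for n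
    by (simp add: sum_lessThan_telescope del: sqrt_iter.simps(2))
  ultimately show ?thesis by simp
qed

definition sqrt_one_minus :: "('a::banach \<Rightarrow>\<^sub>L 'a) \<Rightarrow> 'a \<Rightarrow>\<^sub>L 'a" where
  "sqrt_one_minus B = id_blinfun - lim (sqrt_iter B)"

lemma sqrt_iter_tendsto:
  assumes "norm B \<le> 1"
  shows "(\<lambda>n. sqrt_iter B n x) \<longlonglongrightarrow> x - sqrt_one_minus B x"
proof -
  have "sqrt_iter B \<longlonglongrightarrow> lim (sqrt_iter B)"
    using convergent_sqrt_iter[OF assms] by (simp add: convergent_LIMSEQ_iff)
  then have "(\<lambda>n. sqrt_iter B n x) \<longlonglongrightarrow> lim (sqrt_iter B) x"
    by (intro tendsto_intros)
  then show ?thesis by (simp add: sqrt_one_minus_def blinfun.diff_left)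
qed

text \<open>Used with three choices of \<open>C\<close>: multiplication by a complex scalar for
  complex linearity of the root, a competing square root for uniqueness, and \<open>\<Gamma>\<close>
  or its adjoint to exchange the two defect operators.\<close>

lemma sqrt_one_minus_intertwine:
  assumes "norm B \<le> 1" "norm B' \<le> 1" and "C o\<^sub>L B = B' o\<^sub>L C"
  shows "C (sqrt_one_minus B x) = sqrt_one_minus B' (C x)"
proof -
  have "C (sqrt_iter B n x) = sqrt_iter B' n (C x)" for n
    using sqrt_iter_intertwine[OF assms(3)] by (metis blinfun_apply_blinfun_compose)
  moreover have "(\<lambda>n. C (sqrt_iter B n x)) \<longlonglongrightarrow> C (x - sqrt_one_minus B x)"
    by (intro tendsto_intros sqrt_iter_tendsto assms)
  ultimately have "C (x - sqrt_one_minus B x) = C x - sqrt_one_minus B' (C x)"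
    using sqrt_iter_tendsto[OF assms(2), of "C x"] LIMSEQ_unique by fastforce
  then show ?thesis by (simp add: blinfun.diff_right)
qed

text \<open>The limit \<open>L\<close> solves \<open>L = (B + L\<^sup>2) / 2\<close>, which is
  \<open>(1 - L)\<^sup>2 = 1 - B\<close>.\<close>

lemma sqrt_one_minus_square:
  assumes "norm B \<le> 1"
  shows "sqrt_one_minus B (sqrt_one_minus B x) = x - B x"
proof -
  define L where "L = lim (sqrt_iter B)"
  have L: "sqrt_iter B \<longlonglongrightarrow> L"
    using convergent_sqrt_iter[OF assms] by (simp add: convergent_LIMSEQ_iff L_def)
  have "(\<lambda>n. sqrt_iter B (Suc n)) \<longlonglongrightarrow> (1/2) *\<^sub>R (B + (L o\<^sub>L L))"
    unfolding sqrt_iter.simps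
    by (intro tendsto_intros bounded_bilinear.tendsto[OF bounded_bilinear_blinfun_compose] L)
  then have "(1/2) *\<^sub>R (B + (L o\<^sub>L L)) = L"
    using L LIMSEQ_Suc LIMSEQ_unique by blast
  then have "L x = (1/2) *\<^sub>R (B x + L (L x))"
    by (metis blinfun.scaleR_left blinfun.add_left blinfun_apply_blinfun_compose)
  from arg_cong[OF this, of "scaleR 2"] have "2 *\<^sub>R L x = B x + L (L x)"
    by (simp only: scaleR_scaleR) simp
  then show ?thesis
    by (simp add: sqrt_one_minus_def L_def[symmetric] blinfun.diff_left blinfun.diff_right
        scaleR_2 algebra_simps)
qed

lemma
  fixes B :: "'a::chilbert_space \<Rightarrow>\<^sub>L 'a"
  assumes B: "norm B \<le> 1" and bc: "bounded_clinear B"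
    and sym: "\<And>x y. inner (B x) y = inner x (B y)"
  shows positive_sqrt_one_minus: "positive_op (sqrt_one_minus B)"
    and sqrt_op_one_minus: "sqrt_op (\<lambda>x. x - B x) = sqrt_one_minus B"
proof -
  let ?S = "sqrt_one_minus B"
  show pos: "positive_op ?S"
  proof (rule positive_opI)
    have "?S (a *\<^sub>C x) = a *\<^sub>C ?S x" for a x
    proof -
      \<comment> \<open>The type of \<open>B\<close> records only real linearity; intertwining with
        the scalar multiplication \<open>?C\<close> supplies the complex one.\<close>
      let ?C = "Blinfun (\<lambda>x::'a. a *\<^sub>C x)"
      have C: "blinfun_apply ?C = (\<lambda>x. a *\<^sub>C x)"
        by (rule bounded_linear_Blinfun_apply[OF bounded_linear_scaleC])
      have "?C o\<^sub>L B = B o\<^sub>L ?C"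
        by (rule blinfun_eqI) (simp add: C bounded_clinear_scaleC[OF bc])
      then show ?thesis
        using sqrt_one_minus_intertwine[OF B B, of ?C x] by (simp add: C)
    qed
    then show "bounded_clinear ?S"
      by (simp add: bounded_clinear_def blinfun.bounded_linear_right)
    have symn: "inner (sqrt_iter B n x) y = inner x (sqrt_iter B n y)" for n x y
      by (induction n arbitrary: x y)
        (simp_all add: blinfun.add_left blinfun.scaleR_left inner_add_left inner_add_right sym)
    show "inner (?S x) y = inner x (?S y)" for x y
    proof -
      have "(\<lambda>n. inner (sqrt_iter B n x) y) \<longlonglongrightarrow> inner (x - ?S x) y"
        "(\<lambda>n. inner x (sqrt_iter B n y)) \<longlonglongrightarrow> inner x (y - ?S y)"
        by (intro tendsto_intros sqrt_iter_tendsto B)+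
      then have "inner (x - ?S x) y = inner x (y - ?S y)"
        unfolding symn using LIMSEQ_unique by blast
      then show ?thesis by (simp add: inner_diff_left inner_diff_right)
    qed
    show "inner (?S x) x \<ge> 0" for x
    proof -
      \<comment> \<open>Iterates have norm at most 1; in the limit, 1 minus the limit is
        positive.\<close>
      have le: "inner (sqrt_iter B n x) x \<le> inner x x" for n
      proof -
        have "inner (sqrt_iter B n x) x \<le> norm (sqrt_iter B n x) * norm x"
          by (rule norm_cauchy_schwarz)
        also have "norm (sqrt_iter B n x) \<le> 1 * norm x"
          using norm_blinfun[of "sqrt_iter B n" x] norm_sqrt_iter[OF B, of n]
            sqrt_iter_bound_range[of n] by (meson mult_right_mono norm_ge_zero order_trans)
        finally show ?thesis
          by (simp add: mult_right_mono power2_norm_eq_inner[symmetric] power2_eq_square)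
      qed
      have "(\<lambda>n. inner (sqrt_iter B n x) x) \<longlonglongrightarrow> inner (x - ?S x) x"
        by (intro tendsto_intros sqrt_iter_tendsto B)
      then have "inner (x - ?S x) x \<le> inner x x"
        by (rule LIMSEQ_le_const2) (use le in blast)
      then show ?thesis by (simp add: inner_diff_left)
    qed
  qed
  show "sqrt_op (\<lambda>x. x - B x) = ?S"
    unfolding sqrt_op_def
  proof (rule the_equality)
    show "positive_op ?S \<and> ?S \<circ> ?S = (\<lambda>x. x - B x)"
      using pos sqrt_one_minus_square[OF B] by (auto simp: o_def)
  next
    fix T :: "'a \<Rightarrow> 'a"
    assume T: "positive_op T \<and> T \<circ> T = (\<lambda>x. x - B x)"
    then have bT: "bounded_linear T" by (simp add: positive_op_def bounded_clinear_linear)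
    then interpret T: bounded_linear T .
    have app: "blinfun_apply (Blinfun T) = T"
      by (rule bounded_linear_Blinfun_apply[OF bT])
    have TT: "T (T x) = x - B x" for x
      using T by (metis comp_apply)
    \<comment> \<open>Any square root \<open>T\<close> commutes with its square
      \<open>1 - B\<close>, hence with \<open>B\<close> and with the constructed root.\<close>
    have "T (B x) = B (T x)" for x
      using TT[of "T x"] arg_cong[OF TT[of x], of T] by (simp add: T.diff)
    then have "Blinfun T o\<^sub>L B = B o\<^sub>L Blinfun T"
      by (intro blinfun_eqI) (simp add: app)
    then have "T (?S x) = ?S (T x)" for x
      using sqrt_one_minus_intertwine[OF B B, of "Blinfun T" x] by (simp add: app)
    then have "T \<circ> ?S = ?S \<circ> T" by (simp add: fun_eq_iff)
    moreover have "T \<circ> T = ?S \<circ> ?S"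
      by (simp add: fun_eq_iff TT sqrt_one_minus_square[OF B])
    ultimately show "T = ?S"
      using T pos positive_sqrt_unique by blast
  qed
qed

section \<open>Defect operators of a contraction\<close>

lemma positive_op_clinear: "positive_op A \<Longrightarrow> bounded_clinear A"
  by (simp add: positive_op_def)

lemma cadjoint_positive_op: "positive_op A \<Longrightarrow> cadjoint A = A"
  by (intro cadjointI cinner_adjointI bounded_clinear_scaleC positive_op_clinear positive_op_symmetric)

lemma contraction_op_norm: "contraction_op T \<Longrightarrow> norm (T x) \<le> norm x"
  unfolding contraction_op_def
  by (metis bounded_clinear_linear mult_left_le_one_le norm_ge_zero onorm onorm_pos_le order_trans)

lemma contraction_op_norm_cadjoint:
  assumes "contraction_op T"
  shows "norm (cadjoint T y) \<le> norm y"
proof (cases "cadjoint T y = 0")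
  case False
  have T: "bounded_clinear T" using assms by (simp add: contraction_op_def)
  have "norm (cadjoint T y) * norm (cadjoint T y) = inner (T (cadjoint T y)) y"
    by (simp add: inner_cadjoint[OF T] power2_norm_eq_inner[symmetric] power2_eq_square[symmetric])
  also have "\<dots> \<le> norm (T (cadjoint T y)) * norm y" by (rule norm_cauchy_schwarz)
  also have "\<dots> \<le> norm (cadjoint T y) * norm y"
    by (intro mult_right_mono contraction_op_norm assms) simp
  finally show ?thesis using False by simp
qed simp

text \<open>With \<open>B = cadjoint \<Gamma> \<circ> \<Gamma>\<close> and
  \<open>B' = \<Gamma> \<circ> cadjoint \<Gamma>\<close>, associativity gives
  \<open>\<Gamma> \<circ> B = B' \<circ> \<Gamma>\<close>, and the relation passes to the square
  roots.\<close>

lemma contraction_defect_operators: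
  assumes \<Gamma>: "contraction_op \<Gamma>"
  defines "D \<equiv> sqrt_op (\<lambda>x. x - cadjoint \<Gamma> (\<Gamma> x))"
    and "D' \<equiv> sqrt_op (\<lambda>x. x - \<Gamma> (cadjoint \<Gamma> x))"
  shows "positive_op D" "positive_op D'"
    and "D (D x) = x - cadjoint \<Gamma> (\<Gamma> x)" "D' (D' x) = x - \<Gamma> (cadjoint \<Gamma> x)"
    and "\<Gamma> (D x) = D' (\<Gamma> x)" "cadjoint \<Gamma> (D' x) = D (cadjoint \<Gamma> x)"
proof -
  have bc: "bounded_clinear \<Gamma>" using \<Gamma> by (simp add: contraction_op_def)
  note bc' = bounded_clinear_cadjoint[OF bc]
  let ?G = "Blinfun \<Gamma>" and ?H = "Blinfun (cadjoint \<Gamma>)"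
  have G: "blinfun_apply ?G = \<Gamma>" and H: "blinfun_apply ?H = cadjoint \<Gamma>"
    using bc bc' by (simp_all add: bounded_linear_Blinfun_apply bounded_clinear_linear)
  let ?B = "?H o\<^sub>L ?G" and ?B' = "?G o\<^sub>L ?H"
  have B: "blinfun_apply ?B = cadjoint \<Gamma> \<circ> \<Gamma>" and B': "blinfun_apply ?B' = \<Gamma> \<circ> cadjoint \<Gamma>"
    by (auto simp: G H)
  have n: "norm ?B \<le> 1" "norm ?B' \<le> 1"
    using contraction_op_norm[OF \<Gamma>] contraction_op_norm_cadjoint[OF \<Gamma>] order_trans
    by (fastforce intro!: norm_blinfun_bound simp: B B')+
  have c: "bounded_clinear ?B" "bounded_clinear ?B'"
    unfolding B B' by (intro bounded_clinear_compose bc bc')+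
  have s: "inner (?B x) y = inner x (?B y)" "inner (?B' x) y = inner x (?B' y)" for x y
    by (simp_all add: B B' inner_cadjoint[OF bc] inner_cadjoint'[OF bc])
  have D: "D = sqrt_one_minus ?B" and D': "D' = sqrt_one_minus ?B'"
    using sqrt_op_one_minus[OF n(1) c(1) s(1)] sqrt_op_one_minus[OF n(2) c(2) s(2)]
    by (simp_all add: D_def D'_def G H)
  show "positive_op D" "positive_op D'"
    unfolding D D' by (intro positive_sqrt_one_minus n c s)+
  show "D (D x) = x - cadjoint \<Gamma> (\<Gamma> x)" "D' (D' x) = x - \<Gamma> (cadjoint \<Gamma> x)"
    unfolding D D' using n by (simp_all add: sqrt_one_minus_square G H)
  have "?G o\<^sub>L ?B = ?B' o\<^sub>L ?G" "?H o\<^sub>L ?B' = ?B o\<^sub>L ?H"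
    by (auto intro: blinfun_eqI)
  from sqrt_one_minus_intertwine[OF n this(1)] sqrt_one_minus_intertwine[OF n(2,1) this(2)]
  show "\<Gamma> (D x) = D' (\<Gamma> x)" "cadjoint \<Gamma> (D' x) = D (cadjoint \<Gamma> x)"
    unfolding D D' by (simp_all add: G H)
qed

section \<open>Block operators\<close>

lemma cinner_add_right: "cinner x (y + z) = cinner x y + cinner x (z::'a::complex_inner)"
  by (metis cinner_add_left cinner_commute complex_cnj_add)

lemma cinner_minus_left: "cinner (- x) y = - cinner x (y::'a::complex_inner)"
  using cinner_add_left[of x "- x" y] by (simp add: cinner_zero_left eq_neg_iff_add_eq_0 add.commute)

lemma cinner_minus_right: "cinner x (- y) = - cinner x (y::'a::complex_inner)"
  using cinner_add_right[of x y "- y"] by (simp add: cinner_zero_right eq_neg_iff_add_eq_0 add.commute)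

lemma bounded_clinear_zero: "bounded_clinear (\<lambda>x. 0)"
  by (simp add: bounded_clinear_def bounded_linear_zero scaleC_zero_right)

lemma bounded_clinear_id: "bounded_clinear id"
  by (simp add: bounded_clinear_def id_def bounded_linear_ident)

lemma bounded_clinear_minus: "bounded_clinear T \<Longrightarrow> bounded_clinear (\<lambda>x. - T x)"
  unfolding bounded_clinear_def
  by (metis bounded_linear_minus mult_minus1_right mult_minus_left mult_1 scaleC_minus_left
      scaleC_scaleC scaleC_one)

lemma bounded_clinear_block_op:
  assumes "bounded_clinear A" "bounded_clinear B" "bounded_clinear C" "bounded_clinear D"
  shows "bounded_clinear (block_op A B C D)"
proof -
  have "bounded_linear (\<lambda>p. (A (fst p) + B (snd p), C (fst p) + D (snd p)))"
    using assms[THEN bounded_clinear_linear]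
    by (intro bounded_linear_Pair bounded_linear_add)
      (auto intro: bounded_linear_compose bounded_linear_fst bounded_linear_snd)
  then show ?thesis
    using assms
    by (simp add: bounded_clinear_def block_op_def case_prod_unfold scaleC_prod_def scaleC_add_right)
qed

lemma cadjoint_block_op:
  assumes "bounded_clinear A" "bounded_clinear B" "bounded_clinear C" "bounded_clinear D"
  shows "cadjoint (block_op A B C D) =
    block_op (cadjoint A) (cadjoint C) (cadjoint B) (cadjoint D)"
  by (rule cadjointI)
    (auto simp: block_op_def cinner_prod_def cinner_add_left cinner_add_right cadjoint assms)

lemma cadjoint_id: "cadjoint id = id"
  by (rule cadjointI) simp

lemma cadjoint_zero: "cadjoint (\<lambda>x. 0) = (\<lambda>x. 0)"
  by (rule cadjointI) (simp add: cinner_zero_left cinner_zero_right)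

lemma cadjoint_minus_cadjoint: "bounded_clinear T \<Longrightarrow> cadjoint (\<lambda>x. - cadjoint T x) = (\<lambda>x. - T x)"
  by (rule cadjointI) (simp add: cinner_minus_left cinner_minus_right cinner_cadjoint')

section \<open>The projections and the unitary operator\<close>

lemma orthogonal_projection_P_op: "orthogonal_projection P_op"
proof -
  have "cadjoint P_op = (P_op :: 'a \<times> 'a \<Rightarrow> _)"
    unfolding P_op_def
    by (simp add: cadjoint_block_op bounded_clinear_id bounded_clinear_zero cadjoint_id cadjoint_zero)
  moreover have "bounded_clinear (P_op :: 'a \<times> 'a \<Rightarrow> _)"
    unfolding P_op_def
    by (intro bounded_clinear_block_op bounded_clinear_id bounded_clinear_zero)
  ultimately show ?thesis
    by (auto simp: orthogonal_projection_def P_op_def block_op_def)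
qed

lemma orthogonal_projection_conjugate:
  assumes P: "orthogonal_projection P" and U: "unitary_op U"
  shows "orthogonal_projection (cadjoint U \<circ> P \<circ> U)"
proof -
  have bcU: "bounded_clinear U" and UU: "U (cadjoint U x) = x" for x
    using U by (auto simp: unitary_op_def fun_eq_iff)
  have bcP: "bounded_clinear P" and PP: "P (P x) = P x" and adP: "cadjoint P = P" for x
    using P by (auto simp: orthogonal_projection_def fun_eq_iff)
  have "cadjoint (cadjoint U \<circ> P \<circ> U) = cadjoint U \<circ> P \<circ> U"
  proof (rule cadjointI)
    fix x y
    have "cinner ((cadjoint U \<circ> P \<circ> U) x) y = cinner (P (U x)) (U y)"
      by (simp add: cinner_cadjoint'[OF bcU])
    also have "\<dots> = cinner x ((cadjoint U \<circ> P \<circ> U) y)"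
      by (simp add: cadjoint[OF bcP] adP cadjoint[OF bcU])
    finally show "cinner ((cadjoint U \<circ> P \<circ> U) x) y = cinner x ((cadjoint U \<circ> P \<circ> U) y)" .
  qed
  moreover have "bounded_clinear (cadjoint U \<circ> P \<circ> U)"
    by (intro bounded_clinear_compose bounded_clinear_cadjoint bcU bcP)
  ultimately show ?thesis
    by (auto simp: orthogonal_projection_def UU PP)
qed

text \<open>In both products of \<open>U_op \<Gamma>\<close> with its adjoint, the diagonal entries
  are 1 by the formulas for the squared defect operators, and the off-diagonal entries cancel by the
  intertwining relations.\<close>

lemma unitary_U_op:
  assumes \<Gamma>: "contraction_op \<Gamma>"
  shows "unitary_op (U_op \<Gamma>)"
proof -
  have bc: "bounded_clinear \<Gamma>" using \<Gamma> by (simp add: contraction_op_def)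
  note bc' = bounded_clinear_cadjoint[OF bc]
  note D = contraction_defect_operators[OF \<Gamma>]
  have "bounded_clinear (U_op \<Gamma>)"
    unfolding U_op_def
    by (intro bounded_clinear_block_op bounded_clinear_minus bc bc' positive_op_clinear D)
  moreover have "cadjoint (U_op \<Gamma>) = block_op (cadjoint \<Gamma>)
      (sqrt_op (\<lambda>x. x - cadjoint \<Gamma> (\<Gamma> x))) (sqrt_op (\<lambda>x. x - \<Gamma> (cadjoint \<Gamma> x))) (\<lambda>x. - \<Gamma> x)"
    unfolding U_op_def
    by (simp add: cadjoint_block_op bc bc' bounded_clinear_minus positive_op_clinear D
        cadjoint_positive_op cadjoint_minus_cadjoint)
  moreover note lin = bc[THEN bounded_clinear_linear] bc'[THEN bounded_clinear_linear]
    D(1,2)[THEN positive_op_clinear, THEN bounded_clinear_linear]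
  ultimately show ?thesis
    by (auto simp: unitary_op_def U_op_def block_op_def fun_eq_iff D(3-6)
        linear_simps(1,2)[OF lin(1)] linear_simps(1,2)[OF lin(2)]
        linear_simps(1,2)[OF lin(3)] linear_simps(1,2)[OF lin(4)])
qed

section \<open>Singular value decompositions\<close>

text \<open>An orthonormal system \<open>\<xi>\<close> is injective and thus can be indexed by its own vectors, so the
  index type of a decomposition is arbitrary.\<close>

lemma S_decomposableI:
  fixes \<xi> \<psi> :: "'i \<Rightarrow> 'a::chilbert_space"
  assumes T: "bounded_clinear T"
    and on: "orthonormal_system I \<xi>" "orthonormal_system I \<psi>" and pos: "\<And>n. n \<in> I \<Longrightarrow> s n > 0"
    and sum: "\<And>x. ((\<lambda>n. (complex_of_real (s n) * cinner x (\<xi> n)) *\<^sub>C \<psi> n) has_sum T x) I"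
  shows "S_decomposable T"
proof -
  have inj: "inj_on \<xi> I"
  proof (rule inj_onI, rule ccontr)
    fix i j assume ij: "i \<in> I" "j \<in> I" "\<xi> i = \<xi> j" "i \<noteq> j"
    have "cinner (\<xi> i) (\<xi> j) = 0" "cinner (\<xi> i) (\<xi> i) = 1"
      using on(1) ij(1,2,4) unfolding orthonormal_system_def by (metis, metis)
    then show False using ij(3) by simp
  qed
  let ?g = "the_inv_into I \<xi>"
  have g: "?g (\<xi> n) = n" if "n \<in> I" for n
    using the_inv_into_f_f[OF inj that] .
  have "((\<lambda>v. (complex_of_real (s (?g v)) * cinner x v) *\<^sub>C \<psi> (?g v)) has_sum T x) (\<xi> ` I)" for x
    unfolding has_sum_reindex[OF inj]
    using sum[of x] by (subst has_sum_cong[OF _]) (auto simp: g)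
  moreover have "orthonormal_system (\<xi> ` I) (\<lambda>v. v)" "orthonormal_system (\<xi> ` I) (\<lambda>v. \<psi> (?g v))"
    using on inj by (auto simp: orthonormal_system_def g inj_on_eq_iff)
  moreover have "\<forall>v\<in>\<xi> ` I. s (?g v) > 0"
    using pos by (auto simp: g)
  ultimately show ?thesis
    unfolding S_decomposable_def using T
    by (intro conjI exI[of _ "\<xi> ` I"] exI[of _ "\<lambda>v. s (?g v)"] exI[of _ "\<lambda>v. v"]
        exI[of _ "\<lambda>v. \<psi> (?g v)"]) auto
qed

text \<open>Orthonormality reduces the series in the block comparison to one term.\<close>

lemma has_sum_single:
  assumes "m \<in> A" "\<And>n. n \<in> A \<Longrightarrow> n \<noteq> m \<Longrightarrow> f n = 0"
  shows "(f has_sum f m) A"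
proof -
  have "(f has_sum f m) {m}" by (rule has_sum_finiteI) auto
  then show ?thesis
    using assms by (subst has_sum_cong_neutral[of "{m}" A f f]) auto
qed

text \<open>Only \<open>\<psi>\<close> changes, to its image under \<open>V\<close>: continuity
  takes \<open>V\<close> through the sum and isometry keeps the images orthonormal.\<close>

lemma S_decomposable_isometry_comp:
  fixes T V :: "'a::chilbert_space \<Rightarrow> 'a"
  assumes V: "bounded_clinear V" and iso: "\<And>x y. cinner (V x) (V y) = cinner x y"
    and T: "S_decomposable T"
  shows "S_decomposable (V \<circ> T)"
proof -
  from T obtain I s and \<xi> \<psi> :: "'a \<Rightarrow> 'a" where bc: "bounded_clinear T"
    and on: "orthonormal_system I \<xi>" "orthonormal_system I \<psi>" and pos: "\<forall>n\<in>I. s n > 0"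
    and sum: "\<And>x. ((\<lambda>n. (complex_of_real (s n) * cinner x (\<xi> n)) *\<^sub>C \<psi> n) has_sum T x) I"
    unfolding S_decomposable_def by blast
  show ?thesis
  proof (rule S_decomposableI[where I = I and s = s and \<xi> = \<xi> and \<psi> = "\<lambda>n. V (\<psi> n)"])
    show "bounded_clinear (V \<circ> T)" using V bc by (rule bounded_clinear_compose)
    show "orthonormal_system I (\<lambda>n. V (\<psi> n))"
      using on(2) by (simp add: orthonormal_system_def iso)
    show "((\<lambda>n. (complex_of_real (s n) * cinner x (\<xi> n)) *\<^sub>C V (\<psi> n)) has_sum (V \<circ> T) x) I" for x
      using has_sum_bounded_linear[OF bounded_clinear_linear[OF V] sum[of x]]
      by (simp add: bounded_clinear_scaleC[OF V])
  qed (use on pos in auto)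
qed

text \<open>A decomposition of \<open>\<Gamma>\<close> embeds through \<open>(x, 0)\<close>.
  Conversely, all \<open>\<psi> m\<close> lie in the range of the block operator and all
  \<open>\<xi> m\<close> are orthogonal to vectors \<open>(0, y)\<close> in its kernel, so first
  components form a decomposition of \<open>\<Gamma>\<close>.\<close>

lemma S_decomposable_block_iff:
  fixes \<Gamma> :: "'a::chilbert_space \<Rightarrow> 'a"
  assumes bc: "bounded_clinear \<Gamma>"
  shows "S_decomposable (block_op \<Gamma> (\<lambda>x. 0) (\<lambda>x. 0) (\<lambda>x. 0)) \<longleftrightarrow> S_decomposable \<Gamma>"
    (is "S_decomposable ?T \<longleftrightarrow> _")
proof
  have bcT: "bounded_clinear ?T"
    by (intro bounded_clinear_block_op bc bounded_clinear_zero)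
  have T: "?T p = (\<Gamma> (fst p), 0)" for p
    by (simp add: block_op_def case_prod_beta)
  {
    assume "S_decomposable \<Gamma>"
    then obtain I s and \<xi> \<psi> :: "'a \<Rightarrow> 'a"
      where on: "orthonormal_system I \<xi>" "orthonormal_system I \<psi>" and pos: "\<forall>n\<in>I. s n > 0"
        and sum: "\<And>x. ((\<lambda>n. (complex_of_real (s n) * cinner x (\<xi> n)) *\<^sub>C \<psi> n) has_sum \<Gamma> x) I"
      unfolding S_decomposable_def by blast
    show "S_decomposable ?T"
    proof (rule S_decomposableI[OF bcT, where I = I and s = s])
      show "orthonormal_system I (\<lambda>n. (\<xi> n, 0::'a))" "orthonormal_system I (\<lambda>n. (\<psi> n, 0::'a))"
        using on by (simp_all add: orthonormal_system_def cinner_prod_def cinner_zero_left)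
      have bl: "bounded_linear (\<lambda>x::'a. (x, 0::'a))"
        by (intro bounded_linear_Pair bounded_linear_ident bounded_linear_zero)
      show "((\<lambda>n. (complex_of_real (s n) * cinner p (\<xi> n, 0)) *\<^sub>C (\<psi> n, 0)) has_sum ?T p) I" for p
        using has_sum_bounded_linear[OF bl sum[of "fst p"]]
        by (simp add: T cinner_prod_def cinner_zero_right scaleC_prod_def scaleC_zero_right)
    qed (use pos in auto)
  }
  {
    assume "S_decomposable ?T"
    then obtain I s and \<xi> \<psi> :: "'a \<times> 'a \<Rightarrow> 'a \<times> 'a"
      where on: "orthonormal_system I \<xi>" "orthonormal_system I \<psi>" and pos: "\<forall>n\<in>I. s n > 0"
        and sum: "\<And>x. ((\<lambda>n. (complex_of_real (s n) * cinner x (\<xi> n)) *\<^sub>C \<psi> n) has_sum ?T x) I"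
      unfolding S_decomposable_def by blast
    have on': "cinner (\<xi> i) (\<xi> j) = (if i = j then 1 else 0)"
      "cinner (\<psi> i) (\<psi> j) = (if i = j then 1 else 0)" if "i \<in> I" "j \<in> I" for i j
      using on that by (auto simp: orthonormal_system_def)
    \<comment> \<open>Weak form of the statement that the adjoint of \<open>?T\<close> maps
      \<open>\<psi> m\<close> to \<open>s m\<close> times \<open>\<xi> m\<close>.\<close>
    have coeff: "complex_of_real (s m) * cinner x (\<xi> m) = cinner (?T x) (\<psi> m)" if m: "m \<in> I" for x m
    proof -
      let ?f = "\<lambda>n. cinner ((complex_of_real (s n) * cinner x (\<xi> n)) *\<^sub>C \<psi> n) (\<psi> m)"
      have "(?f has_sum cinner (?T x) (\<psi> m)) I"
        by (rule has_sum_bounded_linear[OF bounded_linear_cinner_left sum])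
      moreover have "(?f has_sum ?f m) I"
        using m by (intro has_sum_single) (auto simp: cinner_scaleC_left on')
      ultimately have "cinner (?T x) (\<psi> m) = ?f m" by (rule has_sum_unique)
      then show ?thesis using m by (simp add: cinner_scaleC_left on')
    qed
    have T\<xi>: "?T (\<xi> m) = complex_of_real (s m) *\<^sub>C \<psi> m" if m: "m \<in> I" for m
    proof -
      let ?f = "\<lambda>n. (complex_of_real (s n) * cinner (\<xi> m) (\<xi> n)) *\<^sub>C \<psi> n"
      have "(?f has_sum ?f m) I"
        using m by (intro has_sum_single) (auto simp: on' scaleC_zero_left)
      from has_sum_unique[OF sum this] show ?thesis using m by (simp add: on')
    qed
    have snd\<psi>: "snd (\<psi> m) = 0" if m: "m \<in> I" for m
    proof -
      have "complex_of_real (s m) *\<^sub>C snd (\<psi> m) = 0"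
        using T\<xi>[OF m] by (simp add: T scaleC_prod_def prod_eq_iff)
      then have "norm (complex_of_real (s m) *\<^sub>C snd (\<psi> m)) = 0" by simp
      then show ?thesis using m pos by (auto simp: norm_scaleC)
    qed
    have snd\<xi>: "snd (\<xi> m) = 0" if m: "m \<in> I" for m
    proof -
      \<comment> \<open>Inserting this kernel vector into \<open>coeff\<close> leaves
        \<open>s m\<close> times the squared norm of \<open>snd (\<xi> m)\<close>.\<close>
      have "?T (0, snd (\<xi> m)) = 0"
        using bc by (simp add: T linear_simps(3)[OF bounded_clinear_linear] zero_prod_def)
      then have "cinner (snd (\<xi> m)) (snd (\<xi> m)) = 0"
        using coeff[OF m, of "(0, snd (\<xi> m))"] m pos
        by (auto simp: cinner_zero_left cinner_prod_def)
      then show ?thesis by (simp add: cinner_eq_Complex complex_eq_iff)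
    qed
    show "S_decomposable \<Gamma>"
    proof (rule S_decomposableI[OF bc, where I = I and s = s])
      show "orthonormal_system I (\<lambda>n. fst (\<xi> n))" "orthonormal_system I (\<lambda>n. fst (\<psi> n))"
        using on by (simp_all add: orthonormal_system_def cinner_prod_def snd\<xi> snd\<psi> cinner_zero_left)
      show "((\<lambda>n. (complex_of_real (s n) * cinner x (fst (\<xi> n))) *\<^sub>C fst (\<psi> n)) has_sum \<Gamma> x) I" for x
        using has_sum_bounded_linear[OF bounded_linear_fst sum[of "(x, 0)"]]
        by (simp add: T cinner_prod_def cinner_zero_left scaleC_prod_def)
    qed (use pos in auto)
  }
qed

theorem mainTheorem17:
  fixes \<Gamma> :: "'a::chilbert_space \<Rightarrow> 'a"
  assumes "contraction_op \<Gamma>"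
  shows "unitary_op (U_op \<Gamma>) \<and>
    orthogonal_projection (P_op :: 'a \<times> 'a \<Rightarrow> 'a \<times> 'a) \<and>
    orthogonal_projection (Q_op \<Gamma>) \<and>
    block_op \<Gamma> (\<lambda>x. 0) (\<lambda>x. 0) (\<lambda>x. 0) = U_op \<Gamma> \<circ> Q_op \<Gamma> \<circ> P_op \<and>
    (S_decomposable \<Gamma> \<longleftrightarrow> S_decomposable (Q_op \<Gamma> \<circ> P_op))"
proof -
  let ?U = "U_op \<Gamma>" and ?T = "block_op \<Gamma> (\<lambda>x. 0) (\<lambda>x. 0) (\<lambda>x. 0)"
  note D = contraction_defect_operators(1,2)[OF assms, THEN positive_op_clinear, THEN bounded_clinear_linear]
  have bc: "bounded_clinear \<Gamma>" using assms by (simp add: contraction_op_def)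
  have U: "unitary_op ?U" using assms by (rule unitary_U_op)
  then have bcU: "bounded_clinear ?U"
    and UU: "cadjoint ?U (?U p) = p" "?U (cadjoint ?U p) = p" for p
    unfolding unitary_op_def by (auto dest: fun_cong[of _ _ p])
  have bcU': "bounded_clinear (cadjoint ?U)" using bcU by (rule bounded_clinear_cadjoint)
  have Q: "orthogonal_projection (Q_op \<Gamma>)"
    unfolding Q_op_def by (rule orthogonal_projection_conjugate[OF orthogonal_projection_P_op U])
  \<comment> \<open>Compression by \<open>P_op\<close> keeps only the 1,1 entry of
    \<open>?U\<close>.\<close>
  have "(P_op \<circ> ?U \<circ> P_op) p = ?T p" for p
    by (simp add: P_op_def U_op_def block_op_def case_prod_beta D[THEN linear_simps(3)])
  then have PUP: "P_op (?U (P_op p)) = ?T p" for p by simp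
  \<comment> \<open>\<open>?U\<close> cancels the adjoint inside \<open>Q_op \<Gamma>\<close>, which
    turns \<open>?U \<circ> Q_op \<Gamma> \<circ> P_op\<close> into the compression.\<close>
  then have eq: "?T = ?U \<circ> Q_op \<Gamma> \<circ> P_op" and eq': "Q_op \<Gamma> \<circ> P_op = cadjoint ?U \<circ> ?T"
    by (auto simp: fun_eq_iff Q_op_def UU)
  \<comment> \<open>The two operators differ by a left factor \<open>?U\<close> or its adjoint; both
    factors are isometric because they are mutually inverse.\<close>
  have "S_decomposable ?T \<longleftrightarrow> S_decomposable (Q_op \<Gamma> \<circ> P_op)"
  proof
    assume "S_decomposable ?T"
    then show "S_decomposable (Q_op \<Gamma> \<circ> P_op)"
      unfolding eq' using bcU'
      by (intro S_decomposable_isometry_comp) (auto simp: cinner_cadjoint'[OF bcU] UU)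
  next
    assume "S_decomposable (Q_op \<Gamma> \<circ> P_op)"
    then have "S_decomposable (?U \<circ> (Q_op \<Gamma> \<circ> P_op))"
      by (intro S_decomposable_isometry_comp[OF bcU]) (auto simp: cadjoint[OF bcU] UU)
    then show "S_decomposable ?T" by (simp add: eq o_assoc)
  qed
  then show ?thesis
    using U Q eq orthogonal_projection_P_op S_decomposable_block_iff[OF bc] by blast
qed

end
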